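(* Let $K,K'$ be edge-path connected simplicial complexes, let $\varphi,\psi:K\to K'$ be simplicial maps, and let $m,n\ge 0$ be integers. Then: (1) $\mathrm{SD}_m(\varphi,\psi)\le\mathrm{SD}(\varphi,\psi)$. (2) If $n\le m$, then $\mathrm{SD}_n(\varphi,\psi)\le\mathrm{SD}_m(\varphi,\psi)$.
   Context: Simplicial complexes are abstract simplicial complexes. Simplicial maps $f,g:A\to B$ are contiguous, $f\sim_c g$, if for every simplex $\{v_0,\dots,v_k\}$ of $A$ the set $\{f(v_0),\dots,f(v_k),g(v_0),\dots,g(v_k)\}$ is a simplex of $B$. They are in the same contiguity class, $f\sim g$, if there is a finite sequence of simplicial maps $f=f_0\sim_c f_1\sim_c\dots\sim_c f_n=g$ from $A$ to $B$. The contiguity distance $\mathrm{SD}(\varphi,\psi)$ is the least integer $k\ge 0$ such that $K$ is covered by subcomplexes $K_0,\dots,K_k$ with $\varphi|_{K_j}\sim\psi|_{K_j}$ for all $j$ ($\infty$ if no such cover exists). For an integer $m\ge 0$, the $m$-contiguity distance $\mathrm{SD}_m(\varphi,\psi)$ is the least integer $k\ge 0$ such that $K$ is covered by subcomplexes $K_0,\dots,K_k$ with the property that for each $j$ and every simplicial map $\eta:P\to K_j$ from an $m$-dimensional simplicial complex $P$, $\varphi\circ\eta\sim\psi\circ\eta$ ($\infty$ if no such cover exists). *)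

theory Defs
  imports Main "HOL-Library.Extended_Nat"
begin

text \<open>
  An abstract simplicial complex is identified with its set of (nonempty, finite) simplices.
\<close>

definition abstract_simplicial_complex :: "'a set set \<Rightarrow> bool" where
  "abstract_simplicial_complex K \<longleftrightarrow>
     (\<forall>s\<in>K. finite s \<and> s \<noteq> {}) \<and> (\<forall>s\<in>K. \<forall>t. t \<subseteq> s \<and> t \<noteq> {} \<longrightarrow> t \<in> K)"

definition vertices :: "'a set set \<Rightarrow> 'a set" where
  "vertices K = \<Union>K"

definition subcomplex :: "'a set set \<Rightarrow> 'a set set \<Rightarrow> bool" where
  "subcomplex L K \<longleftrightarrow> abstract_simplicial_complex L \<and> L \<subseteq> K"

definition has_dimension :: "'a set set \<Rightarrow> nat \<Rightarrow> bool" where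
  "has_dimension P m \<longleftrightarrow> (\<exists>s\<in>P. card s = m + 1) \<and> (\<forall>s\<in>P. card s \<le> m + 1)"

text \<open>Constant steps are allowed in an edge path, since \<open>{v, v} = {v}\<close> is a simplex.\<close>

definition edge_path_connected :: "'a set set \<Rightarrow> bool" where
  "edge_path_connected K \<longleftrightarrow>
     (\<forall>v\<in>vertices K. \<forall>w\<in>vertices K.
        \<exists>n (p :: nat \<Rightarrow> 'a). p 0 = v \<and> p n = w \<and> (\<forall>i<n. {p i, p (Suc i)} \<in> K))"

text \<open>
  A simplicial map is represented by a total function on the vertex type. Its values outside
  the vertex set of the domain are irrelevant, so restricting a map to a subcomplex only
  changes the domain argument of the predicates below.
\<close>

definition simplicial_map :: "'a set set \<Rightarrow> 'b set set \<Rightarrow> ('a \<Rightarrow> 'b) \<Rightarrow> bool" where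
  "simplicial_map A B f \<longleftrightarrow> (\<forall>s\<in>A. f ` s \<in> B)"

definition contiguous :: "'a set set \<Rightarrow> 'b set set \<Rightarrow> ('a \<Rightarrow> 'b) \<Rightarrow> ('a \<Rightarrow> 'b) \<Rightarrow> bool" where
  "contiguous A B f g \<longleftrightarrow>
     simplicial_map A B f \<and> simplicial_map A B g \<and> (\<forall>s\<in>A. f ` s \<union> g ` s \<in> B)"

definition same_contiguity_class ::
    "'a set set \<Rightarrow> 'b set set \<Rightarrow> ('a \<Rightarrow> 'b) \<Rightarrow> ('a \<Rightarrow> 'b) \<Rightarrow> bool" where
  "same_contiguity_class A B f g \<longleftrightarrow>
     (\<exists>n (h :: nat \<Rightarrow> 'a \<Rightarrow> 'b). h 0 = f \<and> h n = g \<and>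
        (\<forall>i\<le>n. simplicial_map A B (h i)) \<and> (\<forall>i<n. contiguous A B (h i) (h (Suc i))))"

definition covered_by :: "'a set set \<Rightarrow> nat \<Rightarrow> (nat \<Rightarrow> 'a set set) \<Rightarrow> bool" where
  "covered_by K k L \<longleftrightarrow> (\<forall>j\<le>k. subcomplex (L j) K) \<and> K = (\<Union>j\<le>k. L j)"

text \<open>In \<^typ>\<open>enat\<close>, the infimum of a nonempty set is its least element, and \<open>Inf {} = \<infinity>\<close>.\<close>

definition SD :: "'a set set \<Rightarrow> 'b set set \<Rightarrow> ('a \<Rightarrow> 'b) \<Rightarrow> ('a \<Rightarrow> 'b) \<Rightarrow> enat" where
  "SD K K' \<phi> \<psi> =
     Inf {enat k | k. \<exists>L. covered_by K k L \<and> (\<forall>j\<le>k. same_contiguity_class (L j) K' \<phi> \<psi>)}"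

text \<open>
  HOL cannot quantify over all vertex types of the test complexes \<open>P\<close>. The type
  \<^typ>\<open>'a + nat\<close> has room for a copy of the \<open>m\<close>-skeleton of \<open>L\<close> together with a disjoint
  \<open>m\<close>-simplex, and testing on that complex is enough: by the lemma
  \<open>m_contiguity_property_any_type\<close> below, the property then holds for test complexes over
  every vertex type.
\<close>

definition m_contiguity_property ::
    "nat \<Rightarrow> 'a set set \<Rightarrow> 'b set set \<Rightarrow> ('a \<Rightarrow> 'b) \<Rightarrow> ('a \<Rightarrow> 'b) \<Rightarrow> bool" where
  "m_contiguity_property m L K' \<phi> \<psi> \<longleftrightarrow>
     (\<forall>(P :: ('a + nat) set set) \<eta>.
        abstract_simplicial_complex P \<and> has_dimension P m \<and> simplicial_map P L \<eta> \<longrightarrow>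
        same_contiguity_class P K' (\<phi> \<circ> \<eta>) (\<psi> \<circ> \<eta>))"

definition SD_m ::
    "nat \<Rightarrow> 'a set set \<Rightarrow> 'b set set \<Rightarrow> ('a \<Rightarrow> 'b) \<Rightarrow> ('a \<Rightarrow> 'b) \<Rightarrow> enat" where
  "SD_m m K K' \<phi> \<psi> =
     Inf {enat k | k. \<exists>L. covered_by K k L \<and> (\<forall>j\<le>k. m_contiguity_property m (L j) K' \<phi> \<psi>)}"

lemma same_contiguity_class_precompose:
  assumes "same_contiguity_class A B f g" "simplicial_map C A \<theta>"
  shows "same_contiguity_class C B (f \<circ> \<theta>) (g \<circ> \<theta>)"
proof -
  obtain n h where h: "h 0 = f" "h n = g" "\<forall>i\<le>n. simplicial_map A B (h i)"
    "\<forall>i<n. contiguous A B (h i) (h (Suc i))"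
    using assms(1) unfolding same_contiguity_class_def by blast
  have "\<forall>i\<le>n. simplicial_map C B (h i \<circ> \<theta>)"
    using h(3) assms(2) unfolding simplicial_map_def image_comp [symmetric] by blast
  moreover have "\<forall>i<n. contiguous C B (h i \<circ> \<theta>) (h (Suc i) \<circ> \<theta>)"
    using h(4) assms(2) unfolding contiguous_def simplicial_map_def image_comp [symmetric] by blast
  ultimately show ?thesis
    unfolding same_contiguity_class_def using h(1,2)
    by (intro exI[of _ n] exI[of _ "\<lambda>i. h i \<circ> \<theta>"]) simp
qed

lemma m_contiguity_property_any_type:
  fixes P :: "'p set set" and L :: "'a set set" and \<eta> :: "'p \<Rightarrow> 'a"
  assumes mcp: "m_contiguity_property m L K' \<phi> \<psi>"
    and L: "abstract_simplicial_complex L"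
    and P: "abstract_simplicial_complex P" "has_dimension P m"
    and \<eta>: "simplicial_map P L \<eta>"
  shows "same_contiguity_class P K' (\<phi> \<circ> \<eta>) (\<psi> \<circ> \<eta>)"
proof -
  obtain s0 where s0: "s0 \<in> P" using P(2) unfolding has_dimension_def by blast
  then have "\<eta> ` s0 \<in> L" using \<eta> unfolding simplicial_map_def by blast
  then obtain v where v: "{v} \<in> L"
    using L unfolding abstract_simplicial_complex_def
    by (metis all_not_in_conv empty_subsetI insert_subset insert_not_empty)
  define S :: "('a + nat) set set" where "S = {Inl ` s | s. s \<in> L \<and> card s \<le> m + 1}"
  define D :: "('a + nat) set set" where "D = {t. t \<subseteq> Inr ` {..m} \<and> t \<noteq> {}}"
  define Q where "Q = S \<union> D"
  define \<zeta> :: "'a + nat \<Rightarrow> 'a" where "\<zeta> = case_sum id (\<lambda>_. v)"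
  have cD: "card t \<le> m + 1" "finite t" if "t \<in> D" for t
  proof -
    have sub: "t \<subseteq> Inr ` {..m}" using that by (simp add: D_def)
    then show "finite t" by (rule finite_subset) simp
    have "card t \<le> card (Inr ` {..m} :: ('a + nat) set)" by (rule card_mono[OF _ sub]) simp
    then show "card t \<le> m + 1" by (simp add: card_image)
  qed
  have Q: "abstract_simplicial_complex Q"
    unfolding abstract_simplicial_complex_def
  proof (intro conjI ballI allI impI)
    fix s assume s: "s \<in> Q"
    show "finite s" "s \<noteq> {}"
      using s L cD(2) by (auto simp: Q_def S_def D_def abstract_simplicial_complex_def)
    fix t assume t: "t \<subseteq> s \<and> t \<noteq> {}"
    show "t \<in> Q"
    proof (cases "s \<in> D")
      case True
      then show ?thesis using t by (auto simp: Q_def D_def)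
    next
      case False
      then obtain u where u: "s = Inl ` u" "u \<in> L" "card u \<le> m + 1"
        using s by (auto simp: Q_def S_def)
      then obtain w where w: "t = Inl ` w" "w \<subseteq> u" using t by (meson subset_imageE)
      have "finite u" using u L by (auto simp: abstract_simplicial_complex_def)
      then have "card w \<le> m + 1" using w u card_mono[of u w] by linarith
      moreover have "w \<noteq> {}" using t w(1) by simp
      then have "w \<in> L" using w(2) u(2) L unfolding abstract_simplicial_complex_def by blast
      ultimately show ?thesis unfolding Q_def S_def using w(1) by blast
    qed
  qed
  have "Inr ` {..m} \<in> D" unfolding D_def by simp
  then have "Inr ` {..m} \<in> Q" unfolding Q_def by simp
  moreover have "card (Inr ` {..m} :: ('a + nat) set) = m + 1"
    by (simp add: card_image)
  moreover have "card s \<le> m + 1" if "s \<in> Q" for s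
    using that cD(1) by (auto simp: Q_def S_def card_image)
  ultimately have dim: "has_dimension Q m" unfolding has_dimension_def by blast
  have "\<zeta> ` s \<in> L" if "s \<in> Q" for s
  proof (cases "s \<in> D")
    case True
    then have s: "s \<subseteq> Inr ` {..m}" "s \<noteq> {}" by (simp_all add: D_def)
    have "\<zeta> x = v" if "x \<in> s" for x using s(1) that by (auto simp: \<zeta>_def)
    then have "\<zeta> ` s = {v}" using s(2) by (simp add: image_constant_conv)
    then show ?thesis using v by simp
  next
    case False
    then show ?thesis using that by (auto simp: Q_def S_def \<zeta>_def image_image)
  qed
  then have "simplicial_map Q L \<zeta>" unfolding simplicial_map_def by blast
  then have c: "same_contiguity_class Q K' (\<phi> \<circ> \<zeta>) (\<psi> \<circ> \<zeta>)"
    using mcp Q dim unfolding m_contiguity_property_def by blast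
  have "(Inl \<circ> \<eta>) ` s \<in> Q" if s: "s \<in> P" for s
  proof -
    have "finite s" using s P(1) unfolding abstract_simplicial_complex_def by blast
    moreover have "card s \<le> m + 1" using s P(2) unfolding has_dimension_def by blast
    ultimately have "card (\<eta> ` s) \<le> m + 1" using card_image_le[of s \<eta>] by linarith
    then show ?thesis
      using s \<eta> unfolding simplicial_map_def Q_def S_def image_comp [symmetric] by blast
  qed
  then have "simplicial_map P Q (Inl \<circ> \<eta>)" unfolding simplicial_map_def by blast
  from same_contiguity_class_precompose[OF c this]
  show ?thesis by (simp add: \<zeta>_def comp_def)
qed

end

theory Submission
  imports Defs
begin

text \<open>
  Both inequalities hold cover by cover. For (1), precomposition with \<open>\<eta>\<close> preserves contiguity
  classes. For (2), an \<open>n\<close>-dimensional complex \<open>P\<close> is a retract of the \<open>m\<close>-dimensional complex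
  obtained by adding a disjoint \<open>m\<close>-simplex, which is collapsed to a vertex of \<open>P\<close>.
\<close>

lemma simplicial_map_comp:
  "simplicial_map A B f \<Longrightarrow> simplicial_map B C g \<Longrightarrow> simplicial_map A C (g \<circ> f)"
  unfolding simplicial_map_def image_comp [symmetric] by blast

text \<open>The added simplex attains dimension \<open>m\<close>, and \<open>n \<le> m\<close> keeps
  the simplices of \<open>P\<close> within the bound. The sum type makes the two pieces disjoint, so
  collapsing one and fixing the other is simplicial.\<close>

lemma retract_of_higher_dimensional_complex:
  fixes P :: "'p set set"
  assumes P: "abstract_simplicial_complex P" "has_dimension P n" and "n \<le> m"
  obtains Q :: "('p + nat) set set" and r
  where "abstract_simplicial_complex Q" "has_dimension Q m"
    "simplicial_map P Q Inl" "simplicial_map Q P r" "r \<circ> Inl = id"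
proof -
  \<comment> \<open>\<open>has_dimension\<close> forces \<open>P\<close> to be nonempty, which
    supplies the vertex \<open>v\<close> onto which the new simplex collapses.\<close>
  obtain s0 where "s0 \<in> P" using P(2) unfolding has_dimension_def by blast
  then obtain v where v: "{v} \<in> P"
    using P(1) unfolding abstract_simplicial_complex_def
    by (metis all_not_in_conv empty_subsetI insert_subset insert_not_empty)
  \<comment> \<open>All faces of one simplex on the \<open>m + 1\<close> vertices tagged by
    \<open>Inr\<close>.\<close>
  define D :: "('p + nat) set set" where "D = {t. t \<subseteq> Inr ` {..m} \<and> t \<noteq> {}}"
  define Q where "Q = image Inl ` P \<union> D"
  define r :: "'p + nat \<Rightarrow> 'p" where "r = case_sum id (\<lambda>_. v)"
  have card_top: "card (Inr ` {..m} :: ('p + nat) set) = m + 1"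
    by (simp add: card_image)
  have Q: "abstract_simplicial_complex Q"
    unfolding abstract_simplicial_complex_def
  proof (intro conjI ballI allI impI)
    fix s assume s: "s \<in> Q"
    show "finite s" "s \<noteq> {}"
      using s P(1) finite_subset[of s "Inr ` {..m}"]
      by (auto simp: Q_def D_def abstract_simplicial_complex_def)
    fix t assume t: "t \<subseteq> s \<and> t \<noteq> {}"
    show "t \<in> Q"
    proof (cases "s \<in> D")
      case True
      then show ?thesis using t by (auto simp: Q_def D_def)
    next
      case False
      then obtain u where u: "s = Inl ` u" "u \<in> P" using s by (auto simp: Q_def)
      then obtain w where w: "t = Inl ` w" "w \<subseteq> u" using t by (meson subset_imageE)
      then have "w \<in> P" using t u(2) P(1) unfolding abstract_simplicial_complex_def by blast
      then show ?thesis unfolding Q_def using w(1) by blast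
    qed
  qed
  have "card s \<le> m + 1" if s: "s \<in> Q" for s
  proof (cases "s \<in> D")
    case True
    then have "card s \<le> card (Inr ` {..m} :: ('p + nat) set)"
      unfolding D_def by (intro card_mono) auto
    then show ?thesis using card_top by simp
  next
    case False
    then obtain u where "s = Inl ` u" "u \<in> P" using s by (auto simp: Q_def)
    moreover have "card u \<le> n + 1"
      using P(2) \<open>u \<in> P\<close> unfolding has_dimension_def by blast
    ultimately show ?thesis using \<open>n \<le> m\<close> by (simp add: card_image)
  qed
  moreover have "Inr ` {..m} \<in> Q" unfolding Q_def D_def by simp
  ultimately have dim: "has_dimension Q m"
    using card_top unfolding has_dimension_def by blast
  have incl: "simplicial_map P Q Inl" unfolding simplicial_map_def Q_def by blast
  \<comment> \<open>No simplex of \<open>Q\<close> mixes the two tags: \<open>r\<close> either sends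
    it to \<open>{v}\<close> or just removes \<open>Inl\<close>.\<close>
  have "r ` s \<in> P" if "s \<in> Q" for s
  proof (cases "s \<in> D")
    case True
    then have "s \<noteq> {}" and "\<And>x. x \<in> s \<Longrightarrow> r x = v" by (auto simp: D_def r_def)
    then have "r ` s = {v}" by (simp add: image_constant_conv)
    then show ?thesis using v by simp
  next
    case False
    then show ?thesis using that by (auto simp: Q_def r_def image_image)
  qed
  then have retr: "simplicial_map Q P r" unfolding simplicial_map_def by blast
  have "r \<circ> Inl = id" by (simp add: r_def fun_eq_iff)
  from that[OF Q dim incl retr this] show thesis .
qed

lemma m_contiguity_property_if_same_contiguity_class:
  "same_contiguity_class L K' \<phi> \<psi> \<Longrightarrow> m_contiguity_property m L K' \<phi> \<psi>"
  unfolding m_contiguity_property_def by (intro allI impI same_contiguity_class_precompose) auto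

text \<open>A test map \<open>\<eta>\<close> on \<open>P\<close> extends along the retraction to
  \<open>\<eta> \<circ> r\<close> on an \<open>m\<close>-dimensional complex. The hypothesis applies
  there, and the resulting chain of contiguities restricts back to \<open>P\<close>.\<close>

lemma m_contiguity_property_antimono:
  assumes mcp: "m_contiguity_property m L K' \<phi> \<psi>"
    and L: "abstract_simplicial_complex L" and "n \<le> m"
  shows "m_contiguity_property n L K' \<phi> \<psi>"
  unfolding m_contiguity_property_def
proof (intro allI impI, elim conjE)
  fix P :: "('a + nat) set set" and \<eta>
  assume P: "abstract_simplicial_complex P" "has_dimension P n" and \<eta>: "simplicial_map P L \<eta>"
  obtain Q :: "(('a + nat) + nat) set set" and r
    where Q: "abstract_simplicial_complex Q" "has_dimension Q m"
      and incl: "simplicial_map P Q Inl" and retr: "simplicial_map Q P r" and id: "r \<circ> Inl = id"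
    using retract_of_higher_dimensional_complex[OF P \<open>n \<le> m\<close>] by blast
  \<comment> \<open>The vertices of \<open>Q\<close> have type \<open>('a + nat) + nat\<close>, not
    the type \<open>'a + nat\<close> fixed in \<open>m_contiguity_property\<close>, so the transfer
    to arbitrary vertex types is required.\<close>
  have "same_contiguity_class Q K' (\<phi> \<circ> (\<eta> \<circ> r)) (\<psi> \<circ> (\<eta> \<circ> r))"
    by (rule m_contiguity_property_any_type[OF mcp L Q simplicial_map_comp[OF retr \<eta>]])
  from same_contiguity_class_precompose[OF this incl]
  show "same_contiguity_class P K' (\<phi> \<circ> \<eta>) (\<psi> \<circ> \<eta>)" by (simp add: comp_assoc id)
qed

theorem proposition3p1:
  fixes K :: "'a set set" and K' :: "'b set set"
    and \<phi> \<psi> :: "'a \<Rightarrow> 'b" and m n :: nat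
  assumes "abstract_simplicial_complex K" and "abstract_simplicial_complex K'"
    and "edge_path_connected K" and "edge_path_connected K'"
    and "simplicial_map K K' \<phi>" and "simplicial_map K K' \<psi>"
  shows "SD_m m K K' \<phi> \<psi> \<le> SD K K' \<phi> \<psi> \<and>
    (n \<le> m \<longrightarrow> SD_m n K K' \<phi> \<psi> \<le> SD_m m K K' \<phi> \<psi>)"
proof (intro conjI impI)
  \<comment> \<open>Each cover admissible for \<open>SD\<close> is admissible for
    \<open>SD_m\<close>, so the infimum for \<open>SD_m\<close> runs over a larger set.\<close>
  show "SD_m m K K' \<phi> \<psi> \<le> SD K K' \<phi> \<psi>"
    unfolding SD_def SD_m_def
    using m_contiguity_property_if_same_contiguity_class by (intro Inf_superset_mono) blast
next
  assume "n \<le> m"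
  \<comment> \<open>Members of a cover are subcomplexes, hence themselves complexes, as the
    antitonicity lemma demands.\<close>
  have "m_contiguity_property n (L j) K' \<phi> \<psi>"
    if "covered_by K k L" "j \<le> k" "m_contiguity_property m (L j) K' \<phi> \<psi>" for k L j
    using that by (intro m_contiguity_property_antimono[OF _ _ \<open>n \<le> m\<close>])
      (auto simp: covered_by_def subcomplex_def)
  then show "SD_m n K K' \<phi> \<psi> \<le> SD_m m K K' \<phi> \<psi>"
    unfolding SD_m_def by (intro Inf_superset_mono) blast
qed

end
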